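(* Let $f$ be a density on $\mathbb{R}$ and $g_0$ a positive density on $\mathbb{R}$, both twice differentiable. For $\alpha\in\mathbb{R}$ put $$\mathcal{R}(\hat f_\alpha)=\int\left[\frac{(g_0(x)^{1-\alpha}f(x))''}{g_0(x)^{1-\alpha}}-\frac{f(x)\,(g_0(x)^{2-\alpha})''}{g_0(x)^{2-\alpha}}\right]^2dx .$$ Define $$b_1(x)=f''(x)-f(x)\frac{g_0''(x)}{g_0(x)},\qquad b_2(x)=2\left\{\frac{g_0'(x)f'(x)}{g_0(x)}-f(x)\left(\frac{g_0'(x)}{g_0(x)}\right)^2\right\},$$ $$c_1=\int\{b_2(x)\}^2dx,\qquad c_2=\int b_2(x)\{b_1(x)+b_2(x)\}\,dx,\qquad c_3=\int\{b_1(x)+b_2(x)\}^2dx,$$ and assume that these integrals are finite and $c_1\neq0$. Then $\mathcal{R}(\hat f_\alpha)$ is minimized over $\alpha\in\mathbb{R}$ at $$\alpha_o=\frac{c_2}{c_1},$$ and its minimum value is $$\min_\alpha\mathcal{R}(\hat f_\alpha)=c_3-\frac{(c_2)^2}{c_1}.$$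
   Context: In the paper, $f$ is the true density of an i.i.d. sample, $g_0(x)=g(x,\theta_0)$ is the best approximation to $f$ within a parametric family $\{g(\cdot,\theta)\}$, and $\mathcal{R}(\hat f_\alpha)$ is the integral of the square of the coefficient of $\frac{h^2}{2}\mu_{2,K}$ (with $\mu_{2,K}=\int z^2K(z)\,dz$) in the bias of the density estimator $\hat f_\alpha(x)=g(x,\hat\theta)\,\frac{n^{-1}\sum_iK_h(X_i-x)g(X_i,\hat\theta)^{1-\alpha}}{\int K_h(t-x)g(t,\hat\theta)^{2-\alpha}dt}$. The symbol $\mathcal{R}(\hat f_\alpha)$ is here defined by the displayed integral and depends only on $f$, $g_0$ and $\alpha$. Integrals are over $\mathbb{R}$ and primes denote derivatives in $x$. *)

theory Defs
  imports "HOL-Analysis.Analysis"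
begin

definition is_pdf :: "(real \<Rightarrow> real) \<Rightarrow> bool" where
  "is_pdf f \<longleftrightarrow> (\<forall>x. 0 \<le> f x) \<and> integrable lborel f \<and> (\<integral>x. f x \<partial>lborel) = 1"

definition twice_differentiable :: "(real \<Rightarrow> real) \<Rightarrow> bool" where
  "twice_differentiable f \<longleftrightarrow>
     (\<forall>x. f differentiable (at x)) \<and> (\<forall>x. deriv f differentiable (at x))"

definition bias_coeff :: "(real \<Rightarrow> real) \<Rightarrow> (real \<Rightarrow> real) \<Rightarrow> real \<Rightarrow> real \<Rightarrow> real" where
  "bias_coeff f g \<alpha> x =
     deriv (deriv (\<lambda>t. g t powr (1 - \<alpha>) * f t)) x / g x powr (1 - \<alpha>)
     - f x * deriv (deriv (\<lambda>t. g t powr (2 - \<alpha>))) x / g x powr (2 - \<alpha>)"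

text \<open>The Bochner integral of a non-integrable function is 0, so statements about this
  integral are only meaningful together with integrability of the squared bias coefficient.\<close>

definition bias_risk :: "(real \<Rightarrow> real) \<Rightarrow> (real \<Rightarrow> real) \<Rightarrow> real \<Rightarrow> real" where
  "bias_risk f g \<alpha> = (\<integral>x. (bias_coeff f g \<alpha> x)\<^sup>2 \<partial>lborel)"

definition b1 :: "(real \<Rightarrow> real) \<Rightarrow> (real \<Rightarrow> real) \<Rightarrow> real \<Rightarrow> real" where
  "b1 f g x = deriv (deriv f) x - f x * (deriv (deriv g) x / g x)"

definition b2 :: "(real \<Rightarrow> real) \<Rightarrow> (real \<Rightarrow> real) \<Rightarrow> real \<Rightarrow> real" where
  "b2 f g x = 2 * (deriv g x * deriv f x / g x - f x * (deriv g x / g x)\<^sup>2)"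

definition c1 :: "(real \<Rightarrow> real) \<Rightarrow> (real \<Rightarrow> real) \<Rightarrow> real" where
  "c1 f g = (\<integral>x. (b2 f g x)\<^sup>2 \<partial>lborel)"

definition c2 :: "(real \<Rightarrow> real) \<Rightarrow> (real \<Rightarrow> real) \<Rightarrow> real" where
  "c2 f g = (\<integral>x. b2 f g x * (b1 f g x + b2 f g x) \<partial>lborel)"

definition c3 :: "(real \<Rightarrow> real) \<Rightarrow> (real \<Rightarrow> real) \<Rightarrow> real" where
  "c3 f g = (\<integral>x. (b1 f g x + b2 f g x)\<^sup>2 \<partial>lborel)"

end

theory Submission
  imports Defs
begin

text \<open>The weight \<open>g powr a\<close> conjugates differentiation into \<open>u \<mapsto> u' + a (g'/g) u\<close>. Applying
  this twice shows that the bias coefficient is \<open>b\<^sub>1 + (1 - \<alpha>) b\<^sub>2\<close>, affine in \<open>\<alpha>\<close>, so that the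
  risk is the quadratic \<open>c\<^sub>3 - 2 \<alpha> c\<^sub>2 + \<alpha>\<^sup>2 c\<^sub>1\<close>, with \<open>c\<^sub>1 > 0\<close>.\<close>

text \<open>Pulling out \<open>g powr a\<close> gives the derivative the same shape as the original
  function, so the rule applies again to its own result.\<close>

lemma has_field_derivative_powr_mult:
  fixes g u :: "real \<Rightarrow> real"
  assumes "g x > 0"
    and "(g has_field_derivative g') (at x)" and "(u has_field_derivative u') (at x)"
  shows "((\<lambda>t. g t powr a * u t) has_field_derivative
      g x powr a * (u' + a * (g' / g x) * u x)) (at x)"
  using assms by (auto intro!: derivative_eq_intros simp: powr_diff field_simps)

lemma twice_differentiable_DERIV:
  assumes "twice_differentiable f"
  shows "(f has_field_derivative deriv f x) (at x)"
    and "(deriv f has_field_derivative deriv (deriv f) x) (at x)"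
  using assms unfolding twice_differentiable_def
  by (auto simp: DERIV_deriv_iff_real_differentiable)

text \<open>The factor \<open>a * (a - 1)\<close> collects a^2 (g'/g)^2 f from the repeated
  zeroth-order term and -a (g'/g)^2 f from (g'/g)' = g''/g - (g'/g)^2.\<close>

lemma deriv_deriv_powr_mult:
  fixes f g :: "real \<Rightarrow> real"
  assumes pos: "\<And>x. g x > 0" and f: "twice_differentiable f" and g: "twice_differentiable g"
  shows "deriv (deriv (\<lambda>t. g t powr a * f t)) x / g x powr a =
    deriv (deriv f) x + 2 * a * (deriv g x * deriv f x / g x)
    + a * f x * (deriv (deriv g) x / g x) + a * (a - 1) * f x * (deriv g x / g x)\<^sup>2"
proof -
  define h where "h = (\<lambda>t. deriv f t + a * (deriv g t / g t) * f t)"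
  have first: "deriv (\<lambda>t. g t powr a * f t) = (\<lambda>t. g t powr a * h t)"
    unfolding h_def
    by (intro ext DERIV_imp_deriv has_field_derivative_powr_mult pos
        twice_differentiable_DERIV f g)
  have h': "(h has_field_derivative deriv (deriv f) x
      + a * ((deriv (deriv g) x / g x - (deriv g x / g x)\<^sup>2) * f x
        + deriv g x / g x * deriv f x)) (at x)"
    unfolding h_def using pos[of x]
    by (auto intro!: derivative_eq_intros twice_differentiable_DERIV f g
        simp: field_simps power2_eq_square)
  have "deriv (\<lambda>t. g t powr a * h t) x = g x powr a * (deriv (deriv f) x
      + a * ((deriv (deriv g) x / g x - (deriv g x / g x)\<^sup>2) * f x
        + deriv g x / g x * deriv f x) + a * (deriv g x / g x) * h x)"
    by (intro DERIV_imp_deriv has_field_derivative_powr_mult pos h'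
        twice_differentiable_DERIV g)
  then have "deriv (\<lambda>t. g t powr a * h t) x / g x powr a = deriv (deriv f) x
      + a * ((deriv (deriv g) x / g x - (deriv g x / g x)\<^sup>2) * f x
        + deriv g x / g x * deriv f x) + a * (deriv g x / g x) * h x"
    using pos[of x] by simp
  then show ?thesis
    \<comment> \<open>Splitting the products in numerators leaves quotients such as g'/g and g''/g
      as atoms of a polynomial identity.\<close>
    unfolding first h_def times_divide_eq_left[symmetric] times_divide_eq_right[symmetric]
    by algebra
qed

text \<open>With a = 1 - \<alpha> the two weights have exponents a and a + 1. The terms quadratic in
  a cancel: f g''/g keeps a - (a + 1) = -1, and f (g'/g)^2 keeps a (a - 1) - (a + 1) a = -2
  a.\<close>

lemma bias_coeff_affine:
  assumes "\<And>x. g x > 0" and "twice_differentiable f" and "twice_differentiable g"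
  shows "bias_coeff f g \<alpha> x = b1 f g x + b2 f g x - \<alpha> * b2 f g x"
proof -
  \<comment> \<open>The pure weight is the product rule's case of the constant function 1, whose
    derivatives vanish.\<close>
  have "twice_differentiable (\<lambda>_. 1)"
    by (simp add: twice_differentiable_def)
  from deriv_deriv_powr_mult[OF assms(1) this assms(3), of "2 - \<alpha>" x]
  have weight: "deriv (deriv (\<lambda>t. g t powr (2 - \<alpha>))) x / g x powr (2 - \<alpha>) =
      (2 - \<alpha>) * (deriv (deriv g) x / g x) + (2 - \<alpha>) * (1 - \<alpha>) * (deriv g x / g x)\<^sup>2"
    by simp
  show ?thesis
    unfolding bias_coeff_def times_divide_eq_right[symmetric]
      deriv_deriv_powr_mult[OF assms] weight b1_def b2_def
    by algebra
qed

text \<open>Expanding the square of the affine coefficient yields precisely the three integrands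
  assumed integrable, so linearity gives both claims.\<close>

lemma bias_risk_quadratic:
  assumes "\<And>x. g x > 0" and "twice_differentiable f" and "twice_differentiable g"
    and int: "integrable lborel (\<lambda>x. (b2 f g x)\<^sup>2)"
      "integrable lborel (\<lambda>x. b2 f g x * (b1 f g x + b2 f g x))"
      "integrable lborel (\<lambda>x. (b1 f g x + b2 f g x)\<^sup>2)"
  shows "integrable lborel (\<lambda>x. (bias_coeff f g \<alpha> x)\<^sup>2)"
    and "bias_risk f g \<alpha> = c3 f g - 2 * \<alpha> * c2 f g + \<alpha>\<^sup>2 * c1 f g"
proof -
  have *: "(\<lambda>x. (bias_coeff f g \<alpha> x)\<^sup>2) = (\<lambda>x. (b1 f g x + b2 f g x)\<^sup>2
      - 2 * \<alpha> * (b2 f g x * (b1 f g x + b2 f g x)) + \<alpha>\<^sup>2 * (b2 f g x)\<^sup>2)"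
    by (simp add: bias_coeff_affine[OF assms(1-3)] algebra_simps power2_eq_square)
  show "integrable lborel (\<lambda>x. (bias_coeff f g \<alpha> x)\<^sup>2)"
    unfolding * using int
    by (intro Bochner_Integration.integrable_add Bochner_Integration.integrable_diff
        integrable_mult_right)
  show "bias_risk f g \<alpha> = c3 f g - 2 * \<alpha> * c2 f g + \<alpha>\<^sup>2 * c1 f g"
    unfolding bias_risk_def * c1_def c2_def c3_def using int
    by (simp del: distrib_left_numeral)
qed

theorem proposition1:
  fixes f g\<^sub>0 :: "real \<Rightarrow> real"
  assumes "is_pdf f" and "is_pdf g\<^sub>0"
    and "\<And>x. 0 < g\<^sub>0 x"
    and "twice_differentiable f" and "twice_differentiable g\<^sub>0"
    and "integrable lborel (\<lambda>x. (b2 f g\<^sub>0 x)\<^sup>2)"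
    and "integrable lborel (\<lambda>x. b2 f g\<^sub>0 x * (b1 f g\<^sub>0 x + b2 f g\<^sub>0 x))"
    and "integrable lborel (\<lambda>x. (b1 f g\<^sub>0 x + b2 f g\<^sub>0 x)\<^sup>2)"
    and "c1 f g\<^sub>0 \<noteq> 0"
  shows "(\<forall>\<alpha>. integrable lborel (\<lambda>x. (bias_coeff f g\<^sub>0 \<alpha> x)\<^sup>2))
    \<and> is_arg_min (bias_risk f g\<^sub>0) (\<lambda>\<alpha>. True) (c2 f g\<^sub>0 / c1 f g\<^sub>0)
    \<and> bias_risk f g\<^sub>0 (c2 f g\<^sub>0 / c1 f g\<^sub>0) = c3 f g\<^sub>0 - (c2 f g\<^sub>0)\<^sup>2 / c1 f g\<^sub>0"
proof -
  note risk = bias_risk_quadratic[OF assms(3-8)]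
  \<comment> \<open>An integral of a square is nonnegative, so being nonzero makes it
    positive.\<close>
  have "c1 f g\<^sub>0 > 0"
    using assms(9) by (simp add: c1_def order_less_le)
  \<comment> \<open>Completing the square in \<alpha> exhibits both the minimizer and the
    minimum.\<close>
  then have square: "bias_risk f g\<^sub>0 \<alpha> = c3 f g\<^sub>0 - (c2 f g\<^sub>0)\<^sup>2 / c1 f g\<^sub>0
      + c1 f g\<^sub>0 * (\<alpha> - c2 f g\<^sub>0 / c1 f g\<^sub>0)\<^sup>2" for \<alpha>
    by (simp add: risk(2) field_simps power2_eq_square)
  then have "is_arg_min (bias_risk f g\<^sub>0) (\<lambda>\<alpha>. True) (c2 f g\<^sub>0 / c1 f g\<^sub>0)"
    using \<open>c1 f g\<^sub>0 > 0\<close> by (simp add: is_arg_min_linorder)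
  then show ?thesis
    using risk(1) square by simp
qed

end
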